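(* There is an absolute constant $C>0$ such that for every integer $d \ge 2$ the following holds: if $P \subseteq \mathbb{R}^d$ is a lattice polytope (all vertices in $\mathbb{Z}^d$) whose vertex set is in general position and whose interior contains no point of $\mathbb{Z}^d$, then $P$ has at most $C\, d^2 (\log d)^3$ vertices.
   Context: A set of points in $\mathbb{R}^d$ is in general position if no $d+1$ of its points lie in a common (affine) hyperplane. *)

theory Defs
  imports Complex_Main
begin

text \<open>Points of R^d are encoded as functions nat => real vanishing at all
  coordinates i >= d (the dimension d varies inside the statement, so a
  type-indexed dimension cannot be used).\<close>

definition Rd :: "nat \<Rightarrow> (nat \<Rightarrow> real) set" where
  "Rd d = {x. \<forall>i\<ge>d. x i = 0}"

definition lattice_point :: "nat \<Rightarrow> (nat \<Rightarrow> real) \<Rightarrow> bool" where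
  "lattice_point d x \<longleftrightarrow> x \<in> Rd d \<and> (\<forall>i<d. x i \<in> \<int>)"

definition conv_hull :: "(nat \<Rightarrow> real) set \<Rightarrow> (nat \<Rightarrow> real) set" where
  "conv_hull V = {x. \<exists>u. (\<forall>v\<in>V. 0 \<le> u v) \<and> (\<Sum>v\<in>V. u v) = 1 \<and>
                        x = (\<lambda>i. \<Sum>v\<in>V. u v * v i)}"

definition vertices :: "(nat \<Rightarrow> real) set \<Rightarrow> (nat \<Rightarrow> real) set" where
  "vertices P = {v \<in> P. \<not> (\<exists>a\<in>P. \<exists>b\<in>P. \<exists>t::real. 0 < t \<and> t < 1 \<and> a \<noteq> b \<and>
                         v = (\<lambda>i. (1 - t) * a i + t * b i))}"

definition interior_d :: "nat \<Rightarrow> (nat \<Rightarrow> real) set \<Rightarrow> (nat \<Rightarrow> real) set" where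
  "interior_d d P = {x \<in> P \<inter> Rd d. \<exists>e>0. \<forall>y\<in>Rd d.
       (\<Sum>i<d. (y i - x i)\<^sup>2) < e\<^sup>2 \<longrightarrow> y \<in> P}"

definition hyperplane_d :: "nat \<Rightarrow> (nat \<Rightarrow> real) set \<Rightarrow> bool" where
  "hyperplane_d d H \<longleftrightarrow> (\<exists>a b. (\<exists>i<d. a i \<noteq> 0) \<and>
       H = {x \<in> Rd d. (\<Sum>i<d. a i * x i) = b})"

definition general_position :: "nat \<Rightarrow> (nat \<Rightarrow> real) set \<Rightarrow> bool" where
  "general_position d S \<longleftrightarrow>
     (\<forall>T\<subseteq>S. card T = d + 1 \<longrightarrow> \<not> (\<exists>H. hyperplane_d d H \<and> T \<subseteq> H))"

end

theory Submission
  imports Defs "HOL-Analysis.Complex_Transcendental" "Jordan_Normal_Form.Determinant"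
begin

text \<open>
  Fix \<open>d + 1\<close> of the vertices, \<open>v\<close> and \<open>h\<^sub>0, \<dots>, h\<^sub>d\<^sub>-\<^sub>1\<close>, and a large integer \<open>p\<close> coprime to all nonzero
  determinants spanned by the vertices, so that general position persists modulo \<open>p\<close>: for \<open>y \<noteq> 0\<close>
  modulo \<open>p\<close>, each residue is the value \<open>\<langle>y, x\<rangle>\<close> of at most \<open>d\<close> vertices \<open>x\<close>. The point
  \<open>v + (\<Sum>\<^sub>i b\<^sub>i (h\<^sub>i - v) + \<Sum>\<^sub>j a\<^sub>j (x\<^sub>j - v)) / p\<close> is an interior lattice point as soon as the
  numerator is divisible by \<open>p\<close>, with \<open>b\<^sub>i \<ge> 1\<close> and \<open>a\<^sub>j \<ge> 0\<close> of total sum below \<open>p\<close> and vertices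
  \<open>x\<^sub>1, \<dots>, x\<^sub>m\<close>. Such solutions are counted with characters modulo \<open>p\<close>. Letting \<open>x\<^sub>j\<close> and
  \<open>a\<^sub>j < p / (2 m)\<close> vary, each \<open>j\<close> contributes a factor of relative size at most \<open>1/2\<close> at every
  \<open>y \<noteq> 0\<close>, provided there are at least \<open>64 d m\<close> vertices. Letting \<open>b\<^sub>i - 1\<close> be a sum of two numbers
  below \<open>p / (4 d)\<close>, Parseval bounds the remaining sum over all \<open>y\<close> by about \<open>(4 d)\<^sup>d\<close> relative to
  the main term. Hence \<open>m\<close> of order \<open>d log d\<close> suffices, and a hollow polytope has \<open>O(d\<^sup>2 log d)\<close>
  vertices.
\<close>

subsection \<open>Exponential sums modulo p\<close>

definition modchar :: "nat \<Rightarrow> int \<Rightarrow> complex" where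
  "modchar p t = cis (2 * pi * real_of_int t / real p)"

lemma norm_modchar [simp]: "norm (modchar p t) = 1"
  by (simp add: modchar_def)

lemma modchar_add: "modchar p (s + t) = modchar p s * modchar p t"
  by (simp add: modchar_def cis_mult ring_distribs add_divide_distrib)

lemma modchar_sum: "finite I \<Longrightarrow> modchar p (\<Sum>i\<in>I. f i) = (\<Prod>i\<in>I. modchar p (f i))"
  by (induction I rule: finite_induct) (simp_all add: modchar_add, simp add: modchar_def)

lemma cnj_modchar: "cnj (modchar p t) = modchar p (- t)"
  by (simp add: modchar_def cis_cnj)

lemma modchar_mult_nat: "modchar p (int a * t) = modchar p t ^ a"
  unfolding modchar_def Complex.DeMoivre by (simp add: mult_ac)

lemma norm_one_minus_modchar: "norm (1 - modchar p t) = 2 * \<bar>sin (pi * real_of_int t / real p)\<bar>"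
  using dist_exp_i_1[of "2 * pi * real_of_int t / real p"]
  by (simp add: modchar_def cis_conv_exp norm_minus_commute)

lemma modchar_eq_1_iff:
  assumes "p > 0"
  shows "modchar p t = 1 \<longleftrightarrow> int p dvd t"
proof -
  have "modchar p t = 1 \<longleftrightarrow> norm (1 - modchar p t) = 0"
    by auto
  also have "\<dots> \<longleftrightarrow> (\<exists>i::int. pi * real_of_int t / real p = real_of_int i * pi)"
    by (simp add: norm_one_minus_modchar sin_zero_iff_int2)
  also have "\<dots> \<longleftrightarrow> (\<exists>i::int. real_of_int t = real_of_int (int p * i))"
    using assms by (simp add: field_simps)
  also have "\<dots> \<longleftrightarrow> int p dvd t"
    unfolding of_int_eq_iff dvd_def ..
  finally show ?thesis .
qed

lemma modchar_mod:
  assumes "p > 0"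
  shows "modchar p (t mod int p) = modchar p t"
proof -
  have "modchar p t = modchar p (int p * (t div int p)) * modchar p (t mod int p)"
    by (simp flip: modchar_add)
  then show ?thesis
    using assms by (simp add: modchar_eq_1_iff[THEN iffD2])
qed

lemma sum_modchar_PiE:
  assumes "finite I" "\<And>i. i \<in> I \<Longrightarrow> finite (Q i)"
  shows "(\<Sum>g\<in>PiE I Q. modchar p (\<Sum>i\<in>I. \<phi> i (g i))) = (\<Prod>i\<in>I. \<Sum>q\<in>Q i. modchar p (\<phi> i q))"
  using assms by (simp add: prod_sum_PiE modchar_sum)

lemma two_div_pi_mult_min_le_sin:
  fixes x :: real
  assumes "0 \<le> x" "x \<le> pi"
  shows "2 * min x (pi - x) / pi \<le> sin x"
proof -
  have "concave_on {0..pi} sin"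
    by (rule f''_le0_imp_concave[where f' = cos and f'' = "\<lambda>x. - sin x"])
       (auto intro!: derivative_eq_intros sin_ge_zero)
  then have chord: "2 * y / pi \<le> sin y" if "0 \<le> y" "y \<le> pi / 2" for y :: real
    using concave_onD[of "{0..pi}" sin "2 * y / pi" 0 "pi / 2"] that by (simp add: field_simps)
  show ?thesis
    using chord[of x] chord[of "pi - x"] assms by (cases "x \<le> pi / 2") (simp_all add: min_def)
qed

lemma norm_one_minus_modchar_ge:
  assumes "p > 0" "int k \<le> t mod int p" "t mod int p \<le> int p - int k"
  shows "4 * real k / real p \<le> norm (1 - modchar p t)"
proof -
  define x where "x = pi * real_of_int (t mod int p) / real p"
  have residue: "real k \<le> real_of_int (t mod int p)" "real k \<le> real p - real_of_int (t mod int p)"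
    using assms(2,3) by linarith+
  have "pi - x = pi * (real p - real_of_int (t mod int p)) / real p"
    using \<open>p > 0\<close> by (simp add: x_def right_diff_distrib diff_divide_distrib)
  then have "pi * real k / real p \<le> pi - x" "pi * real k / real p \<le> x"
    using residue by (simp_all add: x_def divide_right_mono)
  then have "2 * (pi * real k / real p) / pi \<le> 2 * min x (pi - x) / pi"
    by (intro divide_right_mono mult_left_mono) auto
  also have "\<dots> \<le> sin x"
  proof (rule two_div_pi_mult_min_le_sin)
    have "0 \<le> pi * real k / real p"
      by simp
    then show "0 \<le> x" "x \<le> pi"
      using \<open>pi * real k / real p \<le> x\<close> \<open>pi * real k / real p \<le> pi - x\<close> by linarith+
  qed
  finally have "2 * (2 * real k / real p) \<le> 2 * \<bar>sin x\<bar>"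
    by simp
  also have "\<dots> = norm (1 - modchar p t)"
    unfolding x_def norm_one_minus_modchar[symmetric] modchar_mod[OF \<open>p > 0\<close>] ..
  finally show ?thesis by simp
qed

definition char_sum :: "nat \<Rightarrow> nat \<Rightarrow> int \<Rightarrow> complex" where
  "char_sum p n t = (\<Sum>a<n. modchar p (int a * t))"

lemma norm_char_sum_le: "norm (char_sum p n t) \<le> real n"
  unfolding char_sum_def by (rule order_trans[OF norm_sum]) simp

lemma char_sum_mod: "p > 0 \<Longrightarrow> char_sum p n (t mod int p) = char_sum p n t"
  by (simp add: char_sum_def modchar_mult_nat modchar_mod)

lemma one_minus_modchar_mult_char_sum:
  "(1 - modchar p t) * char_sum p n t = 1 - modchar p t ^ n"
  unfolding char_sum_def modchar_mult_nat by (rule one_diff_power_eq[symmetric])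

lemma norm_char_sum_le_quotient:
  assumes "p > 0" "k > 0" "int k \<le> t mod int p" "t mod int p \<le> int p - int k"
  shows "norm (char_sum p n t) \<le> real p / (2 * real k)"
proof -
  have "(4 * real k / real p) * norm (char_sum p n t)
      \<le> norm (1 - modchar p t) * norm (char_sum p n t)"
    using assms by (intro mult_right_mono norm_one_minus_modchar_ge) auto
  also have "\<dots> = norm (1 - modchar p t ^ n)"
    by (simp flip: one_minus_modchar_mult_char_sum norm_mult)
  also have "\<dots> \<le> 2"
    using norm_triangle_ineq4[of 1 "modchar p t ^ n"] by (simp add: norm_power)
  finally show ?thesis
    using assms(1,2) by (simp add: field_simps)
qed

lemma sum_modchar_residues:
  assumes "p > 0"
  shows "(\<Sum>y\<in>{0..<int p}. modchar p (y * t)) = (if int p dvd t then of_nat p else 0)"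
proof -
  have "{0..<int p} = int ` {..<p}"
    by (simp add: image_int_atLeastLessThan lessThan_atLeast0)
  then have "(\<Sum>y\<in>{0..<int p}. modchar p (y * t)) = char_sum p p t"
    by (simp add: char_sum_def sum.reindex)
  also have "\<dots> = (if int p dvd t then of_nat p else 0)"
  proof (cases "int p dvd t")
    case True
    then show ?thesis
      using assms by (simp add: char_sum_def modchar_mult_nat modchar_eq_1_iff[THEN iffD2])
  next
    case False
    have "modchar p t ^ p = 1"
      using assms by (simp add: modchar_eq_1_iff flip: modchar_mult_nat)
    then have "(1 - modchar p t) * char_sum p p t = 0"
      by (simp add: one_minus_modchar_mult_char_sum)
    then show ?thesis
      using False assms by (simp add: modchar_eq_1_iff)
  qed
  finally show ?thesis .
qed

lemma parseval_modchar:
  assumes "p > 0" "A \<subseteq> {..<p}"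
  shows "(\<Sum>t\<in>{0..<int p}. (norm (\<Sum>a\<in>A. modchar p (int a * t)))\<^sup>2) = real p * real (card A)"
proof -
  have square: "complex_of_real ((norm (\<Sum>a\<in>A. modchar p (int a * t)))\<^sup>2)
      = (\<Sum>a\<in>A. \<Sum>b\<in>A. modchar p (t * (int a - int b)))" for t
    by (simp add: complex_norm_square sum_product cnj_modchar algebra_simps
        del: of_real_power flip: modchar_add)
  have orthogonal: "(\<Sum>t\<in>{0..<int p}. modchar p (t * (int a - int b)))
      = (if a = b then of_nat p else 0)"
    if "a \<in> A" "b \<in> A" for a b
  proof -
    have "a < p" "b < p"
      using that assms(2) by auto
    then have "int p dvd int a - int b \<longleftrightarrow> a = b"
      by (metis mod_eq_dvd_iff mod_less of_nat_mod of_nat_eq_iff)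
    then show ?thesis
      using sum_modchar_residues[OF assms(1)] by simp
  qed
  have "complex_of_real (\<Sum>t\<in>{0..<int p}. (norm (\<Sum>a\<in>A. modchar p (int a * t)))\<^sup>2)
      = (\<Sum>t\<in>{0..<int p}. \<Sum>a\<in>A. \<Sum>b\<in>A. modchar p (t * (int a - int b)))"
    unfolding of_real_sum square ..
  also have "\<dots> = (\<Sum>a\<in>A. \<Sum>b\<in>A. \<Sum>t\<in>{0..<int p}. modchar p (t * (int a - int b)))"
    by (subst sum.swap) (intro sum.cong refl sum.swap)
  also have "\<dots> = (\<Sum>a\<in>A. \<Sum>b\<in>A. if a = b then of_nat p else 0)"
    by (intro sum.cong refl orthogonal)
  also have "\<dots> = complex_of_real (real p * real (card A))"
    using finite_subset[OF assms(2)] by simp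
  finally show ?thesis
    unfolding of_real_eq_iff .
qed

lemma card_near_zero_le:
  fixes f :: "'a \<Rightarrow> int"
  assumes "p > 0" "\<And>r. card {x \<in> X. f x mod int p = r} \<le> d"
  shows "card {x \<in> X. f x mod int p \<notin> {int k..int p - int k}} \<le> 2 * k * d"
proof -
  define R where "R = {0..<int k} \<union> {int p - int k<..<int p}"
  have "0 \<le> f x mod int p \<and> f x mod int p < int p" for x
    using \<open>p > 0\<close> by simp
  then have "{x \<in> X. f x mod int p \<notin> {int k..int p - int k}} = (\<Union>r\<in>R. {x \<in> X. f x mod int p = r})"
    by (auto simp: R_def not_le)
  then have "card {x \<in> X. f x mod int p \<notin> {int k..int p - int k}}
      \<le> (\<Sum>r\<in>R. card {x \<in> X. f x mod int p = r})"
    by (simp only:) (rule card_UN_le, simp add: R_def)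
  also have "\<dots> \<le> card R * d"
    using sum_bounded_above[of R _ d] assms(2) by simp
  also have "card R \<le> 2 * k"
    unfolding R_def by (rule order_trans[OF card_Un_le]) simp
  finally show ?thesis
    by simp
qed

lemma norm_sum_char_sum_le_half:
  fixes f :: "'a \<Rightarrow> int"
  assumes "finite X" "p > 0" "\<And>r. card {x \<in> X. f x mod int p = r} \<le> d"
    and "2 * p \<le> k * n" and "8 * k * d \<le> card X"
  shows "norm (\<Sum>x\<in>X. char_sum p n (f x)) \<le> real (card X) * real n / 2"
proof -
  define N where "N = {x \<in> X. f x mod int p \<notin> {int k..int p - int k}}"
  have "k > 0"
    using assms(2,4) by (intro Nat.gr0I) simp
  have far: "norm (char_sum p n (f x)) \<le> real n / 4" if "x \<in> X - N" for x
  proof -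
    have "norm (char_sum p n (f x)) \<le> real p / (2 * real k)"
      using that \<open>p > 0\<close> \<open>k > 0\<close> by (intro norm_char_sum_le_quotient) (auto simp: N_def)
    also have "\<dots> \<le> real n / 4"
      using of_nat_mono[OF assms(4), where 'a = real] \<open>k > 0\<close> by (simp add: field_simps)
    finally show ?thesis .
  qed
  have "4 * card N \<le> card X"
    using card_near_zero_le[of p X f d k] assms(2,3,5) by (simp add: N_def)
  moreover have "card (X - N) \<le> card X"
    using \<open>finite X\<close> by (simp add: card_mono)
  ultimately have cards: "real (card N) \<le> real (card X) / 4" "real (card (X - N)) \<le> real (card X)"
    by linarith+
  have "norm (\<Sum>x\<in>X. char_sum p n (f x)) \<le> (\<Sum>x\<in>X. norm (char_sum p n (f x)))"
    by (rule norm_sum)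
  also have "\<dots> = (\<Sum>x\<in>X - N. norm (char_sum p n (f x))) + (\<Sum>x\<in>N. norm (char_sum p n (f x)))"
    using \<open>finite X\<close> by (intro sum.subset_diff) (auto simp: N_def)
  also have "\<dots> \<le> (\<Sum>x\<in>X - N. real n / 4) + (\<Sum>x\<in>N. real n)"
    by (intro add_mono sum_mono far norm_char_sum_le)
  also have "\<dots> \<le> real (card X) * (real n / 4) + real (card X) / 4 * real n"
    unfolding sum_constant using cards by (intro add_mono mult_right_mono) auto
  finally show ?thesis
    by (simp add: mult_ac)
qed

subsection \<open>Vectors modulo p\<close>

definition dot :: "nat \<Rightarrow> (nat \<Rightarrow> int) \<Rightarrow> (nat \<Rightarrow> int) \<Rightarrow> int" where
  "dot d y x = (\<Sum>i<d. y i * x i)"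

lemma dot_add: "dot d y (\<lambda>c. u c + v c) = dot d y u + dot d y v"
  by (simp add: dot_def distrib_left sum.distrib)

lemma dot_diff: "dot d y (\<lambda>c. u c - v c) = dot d y u - dot d y v"
  by (simp add: dot_def right_diff_distrib sum_subtractf)

lemma dot_diff_left: "dot d (\<lambda>c. y c - z c) x = dot d y x - dot d z x"
  by (simp add: dot_def left_diff_distrib sum_subtractf)

lemma dot_sum: "dot d y (\<lambda>c. \<Sum>i\<in>I. a i * x i c) = (\<Sum>i\<in>I. a i * dot d y (x i))"
  unfolding dot_def sum_distrib_left by (subst sum.swap) (simp add: mult_ac)

lemma dvd_dot: "(\<And>i. i < d \<Longrightarrow> q dvd y i) \<Longrightarrow> q dvd dot d y x"
  unfolding dot_def by (intro dvd_sum dvd_mult2) simp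

definition residue_vectors :: "nat \<Rightarrow> nat \<Rightarrow> (nat \<Rightarrow> int) set" where
  "residue_vectors d p = PiE {..<d} (\<lambda>_. {0..<int p})"

definition nonzero_residue_vectors :: "nat \<Rightarrow> nat \<Rightarrow> (nat \<Rightarrow> int) set" where
  "nonzero_residue_vectors d p = {y \<in> residue_vectors d p. \<exists>i<d. \<not> int p dvd y i}"

lemma finite_residue_vectors [simp]: "finite (residue_vectors d p)"
  by (simp add: residue_vectors_def finite_PiE)

lemma sum_modchar_dot:
  assumes "p > 0"
  shows "(\<Sum>y\<in>residue_vectors d p. modchar p (dot d y x))
    = (if \<forall>i<d. int p dvd x i then of_nat p ^ d else 0)"
proof -
  have "(\<Sum>y\<in>residue_vectors d p. modchar p (dot d y x))
      = (\<Prod>i<d. \<Sum>t\<in>{0..<int p}. modchar p (t * x i))"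
    unfolding residue_vectors_def dot_def by (rule sum_modchar_PiE) simp_all
  also have "\<dots> = (\<Prod>i<d. if int p dvd x i then of_nat p else 0)"
    by (simp add: sum_modchar_residues[OF assms])
  also have "\<dots> = (if \<forall>i<d. int p dvd x i then of_nat p ^ d else 0)"
    by (auto intro!: prod_zero)
  finally show ?thesis .
qed

lemma sum_exponential_sums:
  assumes "p > 0" "finite G"
  shows "(\<Sum>y\<in>residue_vectors d p. \<Sum>g\<in>G. modchar p (dot d y (F g)))
    = of_nat (p ^ d * card {g \<in> G. \<forall>c<d. int p dvd F g c})"
proof -
  have "(\<Sum>y\<in>residue_vectors d p. \<Sum>g\<in>G. modchar p (dot d y (F g)))
      = (\<Sum>g\<in>G. \<Sum>y\<in>residue_vectors d p. modchar p (dot d y (F g)))"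
    by (rule sum.swap)
  also have "\<dots> = (\<Sum>g\<in>G. if \<forall>c<d. int p dvd F g c then of_nat p ^ d else 0)"
    by (simp add: sum_modchar_dot[OF \<open>p > 0\<close>])
  also have "\<dots> = of_nat (p ^ d * card {g \<in> G. \<forall>c<d. int p dvd F g c})"
    using \<open>finite G\<close> by (simp add: mult.commute flip: sum.inter_filter)
  finally show ?thesis .
qed

lemma exists_dvd_if_exponential_sums_small:
  fixes F :: "'g \<Rightarrow> nat \<Rightarrow> int"
  assumes "p > 0" "finite G"
    and small: "(\<Sum>y\<in>nonzero_residue_vectors d p. norm (\<Sum>g\<in>G. modchar p (dot d y (F g))))
      < real (card G)"
  shows "\<exists>g\<in>G. \<forall>c<d. int p dvd F g c"
proof (rule ccontr)
  assume "\<not> (\<exists>g\<in>G. \<forall>c<d. int p dvd F g c)"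
  then have no_solutions: "{g \<in> G. \<forall>c<d. int p dvd F g c} = {}"
    by blast
  define Y where "Y = residue_vectors d p"
  define N where "N = nonzero_residue_vectors d p"
  define T where "T y = (\<Sum>g\<in>G. modchar p (dot d y (F g)))" for y
  have "(\<Sum>y\<in>Y - N. T y) + (\<Sum>y\<in>N. T y) = (\<Sum>y\<in>Y. T y)"
    by (rule sum.subset_diff[symmetric]) (auto simp: Y_def N_def nonzero_residue_vectors_def)
  also have "\<dots> = 0"
    unfolding Y_def T_def sum_exponential_sums[OF assms(1,2)] no_solutions by simp
  finally have cancel: "(\<Sum>y\<in>Y - N. T y) = - (\<Sum>y\<in>N. T y)"
    by (simp add: eq_neg_iff_add_eq_0)
  have "T y = of_nat (card G)" if "y \<in> Y - N" for y
    using that \<open>p > 0\<close> unfolding T_def Y_def N_def nonzero_residue_vectors_def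
    by (simp add: modchar_eq_1_iff[THEN iffD2] dvd_dot)
  then have "norm (\<Sum>y\<in>Y - N. T y) = real (card (Y - N)) * real (card G)"
    by (simp add: norm_mult)
  moreover have "restrict (\<lambda>_. 0) {..<d} \<in> Y - N"
    using \<open>p > 0\<close>
    by (auto simp: Y_def N_def nonzero_residue_vectors_def residue_vectors_def)
  then have "1 \<le> card (Y - N)"
    by (auto simp: Y_def Suc_le_eq card_gt_0_iff)
  then have "real 1 * real (card G) \<le> real (card (Y - N)) * real (card G)"
    by (intro mult_right_mono of_nat_mono) simp_all
  ultimately have "real (card G) \<le> norm (\<Sum>y\<in>N. T y)"
    by (simp add: cancel)
  also have "\<dots> \<le> (\<Sum>y\<in>N. norm (T y))"
    by (rule norm_sum)
  finally show False
    using small by (simp add: N_def T_def)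
qed

text \<open>For \<open>q = 0\<close> the next two notions describe nondegeneracy and general position over the
  integers, since \<open>0 dvd a\<close> means \<open>a = 0\<close> and \<open>a mod 0 = a\<close>.\<close>

definition nonsingular_mod :: "int \<Rightarrow> nat \<Rightarrow> (nat \<Rightarrow> nat \<Rightarrow> int) \<Rightarrow> bool" where
  "nonsingular_mod q d w \<longleftrightarrow>
     (\<forall>y. (\<forall>i<d. q dvd dot d y (w i)) \<longrightarrow> (\<forall>i<d. q dvd y i))"

definition general_position_mod :: "int \<Rightarrow> nat \<Rightarrow> ('a \<Rightarrow> nat \<Rightarrow> int) \<Rightarrow> 'a set \<Rightarrow> bool" where
  "general_position_mod q d f X \<longleftrightarrow>
     (\<forall>y r. (\<exists>i<d. \<not> q dvd y i) \<longrightarrow> card {x \<in> X. dot d y (f x) mod q = r} \<le> d)"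

lemma nonsingular_modD:
  "nonsingular_mod q d w \<Longrightarrow> (\<And>i. i < d \<Longrightarrow> q dvd dot d y (w i)) \<Longrightarrow> j < d \<Longrightarrow> q dvd y j"
  by (simp add: nonsingular_mod_def)

lemma bij_betw_dot_residues:
  assumes "p > 0" "nonsingular_mod (int p) d w"
  shows "bij_betw (\<lambda>y. restrict (\<lambda>i. dot d y (w i) mod int p) {..<d})
    (residue_vectors d p) (residue_vectors d p)" (is "bij_betw ?h ?Y ?Y")
proof -
  have "inj_on ?h ?Y"
  proof (rule inj_onI)
    fix y z assume y: "y \<in> ?Y" and z: "z \<in> ?Y" and eq: "?h y = ?h z"
    have "dot d y (w i) mod int p = dot d z (w i) mod int p" if "i < d" for i
      using fun_cong[OF eq, of i] that by simp
    then have "int p dvd dot d (\<lambda>c. y c - z c) (w i)" if "i < d" for i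
      using that by (simp add: dot_diff_left mod_eq_dvd_iff)
    then have "int p dvd y i - z i" if "i < d" for i
      using nonsingular_modD[OF assms(2), of "\<lambda>c. y c - z c"] that by simp
    then have "y i mod int p = z i mod int p" if "i < d" for i
      using that by (simp add: mod_eq_dvd_iff)
    moreover have "v i mod int p = v i" if "v \<in> ?Y" "i < d" for v i
      using that by (simp add: residue_vectors_def PiE_iff)
    ultimately have "y i = z i" if "i < d" for i
      using y z that by metis
    then show "y = z"
      using PiE_ext[OF y[unfolded residue_vectors_def] z[unfolded residue_vectors_def]] by simp
  qed
  moreover have "?h ` ?Y \<subseteq> ?Y"
    using \<open>p > 0\<close> by (simp add: residue_vectors_def image_subset_iff)
  ultimately show ?thesis
    unfolding bij_betw_def using endo_inj_surj[OF finite_residue_vectors] by blast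
qed

lemma sum_prod_dot_nonsingular:
  fixes \<phi> :: "int \<Rightarrow> 'a :: comm_semiring_1"
  assumes "p > 0" "nonsingular_mod (int p) d w" "\<And>t. \<phi> (t mod int p) = \<phi> t"
  shows "(\<Sum>y\<in>residue_vectors d p. \<Prod>i<d. \<phi> (dot d y (w i))) = (\<Sum>t\<in>{0..<int p}. \<phi> t) ^ d"
proof -
  have "(\<Sum>y\<in>residue_vectors d p. \<Prod>i<d. \<phi> (dot d y (w i)))
      = (\<Sum>y\<in>residue_vectors d p. \<Prod>i<d. \<phi> (restrict (\<lambda>i. dot d y (w i) mod int p) {..<d} i))"
    by (simp add: assms(3))
  also have "\<dots> = (\<Sum>y\<in>residue_vectors d p. \<Prod>i<d. \<phi> (y i))"
    by (rule sum.reindex_bij_betw[OF bij_betw_dot_residues[OF assms(1,2)]])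
  also have "\<dots> = (\<Prod>i<d. \<Sum>t\<in>{0..<int p}. \<phi> t)"
    unfolding residue_vectors_def by (rule prod_sum_PiE[symmetric]) simp_all
  finally show ?thesis
    by simp
qed

lemma nonsingular_if_general_position_mod:
  assumes "finite X" "general_position_mod q d f X" and h: "inj_on h {..d}" "h ` {..d} \<subseteq> X"
  shows "nonsingular_mod q d (\<lambda>i c. f (h i) c - f (h d) c)"
  unfolding nonsingular_mod_def
proof (rule allI, rule impI, rule ccontr)
  fix y assume y: "\<forall>i<d. q dvd dot d y (\<lambda>c. f (h i) c - f (h d) c)" "\<not> (\<forall>i<d. q dvd y i)"
  let ?level = "{x \<in> X. dot d y (f x) mod q = dot d y (f (h d)) mod q}"
  have "dot d y (f (h i)) mod q = dot d y (f (h d)) mod q" if "i \<le> d" for i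
    using y(1) that by (cases "i = d") (simp_all add: dot_diff mod_eq_dvd_iff)
  with h(2) have "h ` {..d} \<subseteq> ?level"
    by blast
  then have "card {..d} \<le> card ?level"
    using \<open>finite X\<close> by (intro card_inj_on_le[OF h(1)]) simp_all
  moreover have "card ?level \<le> d"
    using assms(2) y(2) by (simp add: general_position_mod_def)
  ultimately show False
    by simp
qed

lemma general_position_mod_if_nonsingular:
  assumes "finite X"
    and nonsingular: "\<And>h. inj_on h {..d} \<Longrightarrow> h ` {..d} \<subseteq> X \<Longrightarrow>
      nonsingular_mod q d (\<lambda>i c. f (h i) c - f (h d) c)"
  shows "general_position_mod q d f X"
  unfolding general_position_mod_def
proof (intro allI impI, rule ccontr)
  fix y r assume y: "\<exists>i<d. \<not> q dvd y i"
    and "\<not> card {x \<in> X. dot d y (f x) mod q = r} \<le> d" (is "\<not> card ?level \<le> d")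
  then have "card {..d} \<le> card ?level"
    by simp
  moreover have "finite ?level"
    using \<open>finite X\<close> by simp
  ultimately obtain h where h: "h ` {..d} \<subseteq> ?level" "inj_on h {..d}"
    using card_le_inj[OF finite_atMost] by blast
  then have "h ` {..d} \<subseteq> X"
    by blast
  note edges = nonsingular[OF h(2) this]
  have "dot d y (f (h i)) mod q = r" if "i \<le> d" for i
    using h(1) that by auto
  then have "q dvd dot d y (\<lambda>c. f (h i) c - f (h d) c)" if "i < d" for i
    using that by (simp add: dot_diff mod_eq_dvd_iff[symmetric])
  then show False
    using y nonsingular_modD[OF edges] by blast
qed

lemma general_position_mod_translate:
  assumes "finite X" "general_position_mod q d f X"
  shows "general_position_mod q d (\<lambda>x c. f x c - v c) X"
  using \<open>finite X\<close>
proof (rule general_position_mod_if_nonsingular)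
  fix h assume "inj_on h {..d}" "h ` {..d} \<subseteq> X"
  then show "nonsingular_mod q d (\<lambda>i c. (f (h i) c - v c) - (f (h d) c - v c))"
    using nonsingular_if_general_position_mod[OF assms] by simp
qed

lemma nonsingular_left_inverse:
  assumes "nonsingular_mod 0 d w"
  obtains N D where "D \<noteq> 0"
    "\<And>i j. i < d \<Longrightarrow> j < d \<Longrightarrow> (\<Sum>k<d. N i k * w k j) = (if i = j then D else 0)"
proof
  define M where "M = mat d d (\<lambda>(i, j). w i j)"
  have M: "M \<in> carrier_mat d d" by (simp add: M_def)
  show "det M \<noteq> 0"
  proof
    assume "det M = 0"
    then obtain v where v: "v \<in> carrier_vec d" "v \<noteq> 0\<^sub>v d" "M *\<^sub>v v = 0\<^sub>v d"
      using det_0_iff_vec_prod_zero[OF M] by blast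
    have "dot d (\<lambda>j. v $ j) (w i) = (M *\<^sub>v v) $ i" if "i < d" for i
      using v(1) that by (simp add: M_def dot_def scalar_prod_def lessThan_atLeast0 mult.commute)
    then have "v $ j = 0" if "j < d" for j
      using nonsingular_modD[OF assms, of "\<lambda>j. v $ j"] v(3) that by simp
    then show False
      using v(1,2) by auto
  qed
  fix i j assume "i < d" "j < d"
  moreover have "(adj_mat M * M) $$ (i, j) = (det M \<cdot>\<^sub>m 1\<^sub>m d) $$ (i, j)"
    using adj_mat(3)[OF M] by simp
  ultimately show "(\<Sum>k<d. adj_mat M $$ (i, k) * w k j) = (if i = j then det M else 0)"
    using adj_mat(1)[OF M] by (auto simp: M_def scalar_prod_def lessThan_atLeast0 split: if_splits)
qed

lemma nonsingular_mod_coprime: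
  assumes "nonsingular_mod 0 d w"
  obtains D where "D \<noteq> 0" "\<And>q. coprime q D \<Longrightarrow> nonsingular_mod q d w"
proof -
  obtain N D where D: "D \<noteq> 0" and N: "\<And>i j. i < d \<Longrightarrow> j < d \<Longrightarrow>
      (\<Sum>k<d. N i k * w k j) = (if i = j then D else 0)"
    using nonsingular_left_inverse[OF assms] by metis
  have "nonsingular_mod q d w" if "coprime q D" for q
    unfolding nonsingular_mod_def
  proof (intro allI impI)
    fix y i assume y: "\<forall>i<d. q dvd dot d y (w i)" and "i < d"
    have "q dvd (\<Sum>k<d. N i k * dot d y (w k))"
      using y by (intro dvd_sum dvd_mult) simp
    also have "\<dots> = dot d y (\<lambda>j. \<Sum>k<d. N i k * w k j)"
      by (simp add: dot_sum)
    also have "\<dots> = (\<Sum>j<d. if i = j then y j * D else 0)"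
      unfolding dot_def using \<open>i < d\<close> by (intro sum.cong) (simp_all add: N)
    also have "\<dots> = y i * D"
      using \<open>i < d\<close> by simp
    finally show "q dvd y i"
      using \<open>coprime q D\<close> by (simp add: coprime_dvd_mult_left_iff)
  qed
  with D show ?thesis by (rule that)
qed

lemma uniform_coprime_modulus:
  fixes P :: "'a \<Rightarrow> int \<Rightarrow> bool"
  assumes "finite H"
    and "\<And>h. h \<in> H \<Longrightarrow> \<exists>E. E \<noteq> 0 \<and> (\<forall>q. coprime q E \<longrightarrow> P h q)"
  obtains D :: nat where "D > 0" "\<And>h q. h \<in> H \<Longrightarrow> coprime q (int D) \<Longrightarrow> P h q"
proof -
  obtain E where E: "\<And>h. h \<in> H \<Longrightarrow> E h \<noteq> 0" "\<And>h q. h \<in> H \<Longrightarrow> coprime q (E h) \<Longrightarrow> P h q"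
    using assms(2) by metis
  show ?thesis
  proof (rule that)
    show "nat \<bar>\<Prod>h\<in>H. E h\<bar> > 0"
      using E(1) \<open>finite H\<close> by simp
    fix h q assume "h \<in> H" "coprime q (int (nat \<bar>\<Prod>h\<in>H. E h\<bar>))"
    then have "coprime q (E h)"
      using \<open>finite H\<close> coprime_divisors[OF dvd_refl dvd_prodI, of H h q E] by simp
    with \<open>h \<in> H\<close> show "P h q"
      by (rule E(2))
  qed
qed

lemma general_position_mod_coprime:
  assumes "finite X" "general_position_mod 0 d f X"
  obtains D :: nat where "D > 0" "\<And>q. coprime q (int D) \<Longrightarrow> general_position_mod q d f X"
proof -
  define edges where "edges = (\<lambda>h i c. f (h i) c - f (h d) c)"
  define H where "H = {h \<in> PiE {..d} (\<lambda>_. X). inj_on h {..d}}"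
  have "\<exists>E. E \<noteq> 0 \<and> (\<forall>q. coprime q E \<longrightarrow> nonsingular_mod q d (edges h))" if "h \<in> H" for h
  proof -
    have "nonsingular_mod 0 d (edges h)"
      using that unfolding edges_def H_def
      by (intro nonsingular_if_general_position_mod[OF assms]) auto
    then show ?thesis
      using nonsingular_mod_coprime by metis
  qed
  moreover have "finite H"
    using \<open>finite X\<close> by (simp add: H_def finite_PiE)
  ultimately obtain D :: nat where "D > 0"
    and D: "\<And>h q. h \<in> H \<Longrightarrow> coprime q (int D) \<Longrightarrow> nonsingular_mod q d (edges h)"
    using uniform_coprime_modulus[of H "\<lambda>h q. nonsingular_mod q d (edges h)"] by blast
  have "nonsingular_mod q d (edges h)"
    if "coprime q (int D)" "inj_on h {..d}" "h ` {..d} \<subseteq> X" for h q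
  proof -
    have "restrict h {..d} \<in> H"
      using that by (auto simp: H_def inj_on_def)
    then have "nonsingular_mod q d (edges (restrict h {..d}))"
      using that(1) by (rule D)
    then show ?thesis
      by (simp add: nonsingular_mod_def edges_def)
  qed
  then show ?thesis
    using \<open>finite X\<close> \<open>D > 0\<close> unfolding edges_def
    by (intro that[of D] general_position_mod_if_nonsingular)
qed

lemma general_position_mod_mult_plus_one:
  assumes "finite X" "general_position_mod 0 d f X"
  obtains D :: nat where "D > 0" "\<And>n. general_position_mod (int (n * D + 1)) d f X"
proof -
  obtain D :: nat where "D > 0"
    and D: "\<And>q. coprime q (int D) \<Longrightarrow> general_position_mod q d f X"
    using general_position_mod_coprime[OF assms] by metis
  have "coprime (n * D + 1) D" for n
    using gcd_add_mult[of D n 1] by (simp add: coprime_iff_gcd_eq_1 gcd.commute)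
  then have "coprime (int (n * D + 1)) (int D)" for n
    by (simp only: coprime_int_iff)
  then show ?thesis
    using that[OF \<open>D > 0\<close> D] by blast
qed

subsection \<open>Positive combinations divisible by p\<close>

text \<open>Each coefficient of \<open>u i\<close> below is a sum of two independent numbers, so that its exponential
  sum is a square, to which Parseval's identity applies.\<close>

definition coefficient_choices ::
    "nat \<Rightarrow> nat \<Rightarrow> nat \<Rightarrow> nat \<Rightarrow> 'a set \<Rightarrow> ((nat \<Rightarrow> nat) \<times> (nat \<Rightarrow> nat) \<times> (nat \<Rightarrow> 'a \<times> nat)) set"
  where "coefficient_choices d B m A X =
    PiE {..<d} (\<lambda>_. {..<B}) \<times> PiE {..<d} (\<lambda>_. {..<B}) \<times> PiE {..<m} (\<lambda>_. X \<times> {..<A})"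

definition combination ::
    "nat \<Rightarrow> nat \<Rightarrow> (nat \<Rightarrow> nat \<Rightarrow> int) \<Rightarrow> ('a \<Rightarrow> nat \<Rightarrow> int)
      \<Rightarrow> (nat \<Rightarrow> nat) \<times> (nat \<Rightarrow> nat) \<times> (nat \<Rightarrow> 'a \<times> nat) \<Rightarrow> nat \<Rightarrow> int"
  where "combination d m u f = (\<lambda>(b, b', g) c.
    (\<Sum>i<d. int (b i + b' i + 1) * u i c) + (\<Sum>j<m. int (snd (g j)) * f (fst (g j)) c))"

lemma card_coefficient_choices:
  "card (coefficient_choices d B m A X) = (B ^ d)\<^sup>2 * (card X * A) ^ m"
  by (simp add: coefficient_choices_def card_cartesian_product card_PiE power2_eq_square)

lemma norm_sum_modchar_combination:
  fixes X :: "'a set"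
  assumes "finite X"
  shows "norm (\<Sum>g\<in>coefficient_choices d B m A X. modchar p (dot d y (combination d m u f g)))
    = (\<Prod>i<d. (norm (char_sum p B (dot d y (u i))))\<^sup>2)
      * norm (\<Sum>x\<in>X. char_sum p A (dot d y (f x))) ^ m"
proof -
  define \<beta> where "\<beta> b = modchar p (\<Sum>i<d. int (b i) * dot d y (u i))" for b
  define \<gamma> where "\<gamma> g = modchar p (\<Sum>j<m. int (snd (g j)) * dot d y (f (fst (g j))))"
    for g :: "nat \<Rightarrow> 'a \<times> nat"
  have split: "modchar p (dot d y (combination d m u f (b, b', g)))
      = modchar p (\<Sum>i<d. dot d y (u i)) * (\<beta> b * (\<beta> b' * \<gamma> g))" for b b' g
    unfolding \<beta>_def \<gamma>_def combination_def prod.case dot_add dot_sum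
    by (simp add: distrib_right sum.distrib add_ac flip: modchar_add)
  have "(\<Sum>b\<in>PiE {..<d} (\<lambda>_. {..<B}). \<beta> b) = (\<Prod>i<d. char_sum p B (dot d y (u i)))"
    unfolding \<beta>_def char_sum_def by (rule sum_modchar_PiE) simp_all
  moreover have "(\<Sum>g\<in>PiE {..<m} (\<lambda>_. X \<times> {..<A}). \<gamma> g)
      = (\<Prod>j<m. \<Sum>q\<in>X \<times> {..<A}. modchar p (int (snd q) * dot d y (f (fst q))))"
    unfolding \<gamma>_def using assms
    by (intro sum_modchar_PiE[where \<phi> = "\<lambda>_ q. int (snd q) * dot d y (f (fst q))"]) simp_all
  moreover have "\<dots> = (\<Sum>x\<in>X. char_sum p A (dot d y (f x))) ^ m"
    by (simp add: char_sum_def sum.cartesian_product split_def)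
  moreover have "(\<Sum>g\<in>coefficient_choices d B m A X. modchar p (dot d y (combination d m u f g)))
      = modchar p (\<Sum>i<d. dot d y (u i)) * ((\<Sum>b\<in>PiE {..<d} (\<lambda>_. {..<B}). \<beta> b) *
        ((\<Sum>b\<in>PiE {..<d} (\<lambda>_. {..<B}). \<beta> b) * (\<Sum>g\<in>PiE {..<m} (\<lambda>_. X \<times> {..<A}). \<gamma> g)))"
    by (simp add: coefficient_choices_def sum.cartesian_product' split
        flip: sum_distrib_left sum_distrib_right)
  ultimately show ?thesis
    by (simp add: norm_mult norm_power power2_eq_square prod.distrib flip: prod_norm)
qed

lemma sum_prod_norm_char_sum:
  assumes "p > 0" "B \<le> p" "nonsingular_mod (int p) d u"
  shows "(\<Sum>y\<in>residue_vectors d p. \<Prod>i<d. (norm (char_sum p B (dot d y (u i))))\<^sup>2)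
    = (real p * real B) ^ d"
proof -
  have "(\<Sum>y\<in>residue_vectors d p. \<Prod>i<d. (norm (char_sum p B (dot d y (u i))))\<^sup>2)
      = (\<Sum>t\<in>{0..<int p}. (norm (char_sum p B t))\<^sup>2) ^ d"
    by (intro sum_prod_dot_nonsingular assms) (simp add: char_sum_mod \<open>p > 0\<close>)
  also have "\<dots> = (real p * real B) ^ d"
    using parseval_modchar[of p "{..<B}"] assms by (simp add: char_sum_def)
  finally show ?thesis .
qed

lemma sum_norm_modchar_combination_le:
  fixes X :: "'a set"
  assumes "p > 0" "B \<le> p" "finite X"
    and gp: "general_position_mod (int p) d f X" and u: "nonsingular_mod (int p) d u"
    and window: "2 * p \<le> k * A" and many: "8 * k * d \<le> card X"
  shows "(\<Sum>y\<in>nonzero_residue_vectors d p.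
      norm (\<Sum>g\<in>coefficient_choices d B m A X. modchar p (dot d y (combination d m u f g))))
    \<le> (real p * real B) ^ d * (real (card X) * real A / 2) ^ m"
proof -
  define K where "K y = (\<Prod>i<d. (norm (char_sum p B (dot d y (u i))))\<^sup>2)" for y
  define \<Phi> where "\<Phi> y = (\<Sum>x\<in>X. char_sum p A (dot d y (f x)))" for y
  define M where "M = real (card X) * real A / 2"
  have "K y \<ge> 0" for y
    by (simp add: K_def prod_nonneg)
  have "norm (\<Phi> y) \<le> M" if "y \<in> nonzero_residue_vectors d p" for y
    using gp that unfolding M_def \<Phi>_def nonzero_residue_vectors_def
    by (intro norm_sum_char_sum_le_half[OF \<open>finite X\<close> \<open>p > 0\<close> _ window many])
       (simp add: general_position_mod_def)
  then have "(\<Sum>y\<in>nonzero_residue_vectors d p. K y * norm (\<Phi> y) ^ m)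
      \<le> (\<Sum>y\<in>nonzero_residue_vectors d p. K y * M ^ m)"
    by (intro sum_mono mult_left_mono power_mono \<open>K _ \<ge> 0\<close>) auto
  also have "\<dots> \<le> (\<Sum>y\<in>residue_vectors d p. K y * M ^ m)"
    using \<open>\<And>y. K y \<ge> 0\<close> by (intro sum_mono2) (auto simp: M_def nonzero_residue_vectors_def)
  also have "\<dots> = (real p * real B) ^ d * M ^ m"
    unfolding sum_distrib_right[symmetric] K_def sum_prod_norm_char_sum[OF assms(1,2) u] ..
  finally show ?thesis
    unfolding norm_sum_modchar_combination[OF \<open>finite X\<close>] K_def \<Phi>_def M_def .
qed

lemma exists_positive_combination_dvd:
  fixes X :: "'a set"
  assumes "p > 0" "B \<le> p" and X: "finite X" "X \<noteq> {}"
    and gp: "general_position_mod (int p) d f X" and u: "nonsingular_mod (int p) d u"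
    and window: "2 * p \<le> k * A" and many: "8 * k * d \<le> card X" and modulus: "p ^ d < B ^ d * 2 ^ m"
  obtains b a x where "\<And>i. i < d \<Longrightarrow> 0 < b i \<and> b i < 2 * B" "\<And>j. j < m \<Longrightarrow> x j \<in> X \<and> a j < A"
    "\<And>c. c < d \<Longrightarrow> int p dvd (\<Sum>i<d. int (b i) * u i c) + (\<Sum>j<m. int (a j) * f (x j) c)"
proof -
  define G where "G = coefficient_choices d B m A X"
  have "A > 0"
    using window \<open>p > 0\<close> by (intro Nat.gr0I) simp
  moreover have "card X > 0"
    using X by (simp add: card_gt_0_iff)
  moreover have "B ^ d > 0"
    using modulus by (intro Nat.gr0I) simp
  ultimately have pos: "0 < real (B ^ d * (card X * A) ^ m) / 2 ^ m"
    by simp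
  have "(real p * real B) ^ d * (real (card X) * real A / 2) ^ m
      = real (p ^ d) * (real (B ^ d * (card X * A) ^ m) / 2 ^ m)"
    by (simp add: power_mult_distrib power_divide)
  also have "\<dots> < real (B ^ d * 2 ^ m) * (real (B ^ d * (card X * A) ^ m) / 2 ^ m)"
    using pos modulus by (intro mult_strict_right_mono of_nat_less_iff[THEN iffD2])
  also have "\<dots> = real (card G)"
    by (simp add: G_def card_coefficient_choices power2_eq_square)
  finally have "\<exists>g\<in>G. \<forall>c<d. int p dvd combination d m u f g c"
    unfolding G_def
    using sum_norm_modchar_combination_le[OF assms(1,2) X(1) gp u window many, of m] X(1)
    by (intro exists_dvd_if_exponential_sums_small[OF \<open>p > 0\<close>])
       (simp_all add: coefficient_choices_def finite_PiE)
  then obtain b b' g where "(b, b', g) \<in> G"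
    and dvd: "\<And>c. c < d \<Longrightarrow> int p dvd combination d m u f (b, b', g) c"
    by auto
  then have "b i < B" "b' i < B" if "i < d" for i
    using that by (auto simp: G_def coefficient_choices_def)
  then have "0 < b i + b' i + 1 \<and> b i + b' i + 1 < 2 * B" if "i < d" for i
    using that by force
  moreover have "fst (g j) \<in> X \<and> snd (g j) < A" if "j < m" for j
    using \<open>(b, b', g) \<in> G\<close> that by (auto simp: G_def coefficient_choices_def mem_Times_iff PiE_iff)
  ultimately show ?thesis
    using dvd unfolding combination_def prod.case by (rule that)
qed

lemma power_modulus_less:
  assumes "d > 0" "m > 0" "D > 0" "(8 * d) ^ d \<le> (2 :: nat) ^ m"
  shows "(4 * d * m * D + 1) ^ d < (m * D) ^ d * 2 ^ m"
proof -
  have "1 \<le> d * (m * D)"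
    using assms by simp
  then have "4 * d * m * D + 1 < 8 * d * (m * D)"
    unfolding mult.assoc by linarith
  then have "(4 * d * m * D + 1) ^ d < (8 * d * (m * D)) ^ d"
    using \<open>d > 0\<close> by (intro power_strict_mono) simp_all
  also have "\<dots> = (m * D) ^ d * (8 * d) ^ d"
    by (simp add: power_mult_distrib)
  also have "\<dots> \<le> (m * D) ^ d * 2 ^ m"
    using assms(4) by (rule mult_left_mono) simp
  finally show ?thesis .
qed

lemma exists_small_combination_dvd:
  fixes X :: "'a set"
  assumes "d > 0" "m > 0" "D > 0" "finite X" and p: "p = 4 * d * m * D + 1"
    and gp: "general_position_mod (int p) d f X"
    and h: "inj_on h {..d}" "h ` {..d} \<subseteq> X"
    and many: "64 * d * m \<le> card X" and large: "(8 * d) ^ d \<le> 2 ^ m"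
  obtains b a x where "\<And>i. i < d \<Longrightarrow> 0 < b i" "\<And>j. j < m \<Longrightarrow> x j \<in> X"
    "(\<Sum>i<d. b i) + (\<Sum>j<m. a j) < p"
    "\<And>c. c < d \<Longrightarrow> int p dvd
      (\<Sum>i<d. int (b i) * (f (h i) c - f (h d) c)) + (\<Sum>j<m. int (a j) * (f (x j) c - f (h d) c))"
proof -
  define B where "B = m * D"
  define A where "A = 2 * d * D"
  have "d * m * D \<ge> 1"
    using \<open>d > 0\<close> \<open>m > 0\<close> \<open>D > 0\<close> by simp
  obtain b a x where b: "\<And>i. i < d \<Longrightarrow> 0 < b i \<and> b i < 2 * B"
    and x: "\<And>j. j < m \<Longrightarrow> x j \<in> X \<and> a j < A"
    and dvd: "\<And>c. c < d \<Longrightarrow> int p dvd (\<Sum>i<d. int (b i) * (f (h i) c - f (h d) c))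
      + (\<Sum>j<m. int (a j) * (f (x j) c - f (h d) c))"
  proof (rule exists_positive_combination_dvd)
    show "general_position_mod (int p) d (\<lambda>x c. f x c - f (h d) c) X"
      using \<open>finite X\<close> gp by (rule general_position_mod_translate)
    show "nonsingular_mod (int p) d (\<lambda>i c. f (h i) c - f (h d) c)"
      using \<open>finite X\<close> gp h by (rule nonsingular_if_general_position_mod)
    have "B \<le> 4 * d * B"
      using \<open>d > 0\<close> by simp
    also have "\<dots> \<le> p"
      by (simp add: B_def p mult_ac)
    finally show "B \<le> p" .
    show "p ^ d < B ^ d * 2 ^ m"
      unfolding p B_def using assms(1-3) large by (rule power_modulus_less)
    show "2 * p \<le> (8 * m) * A" "8 * (8 * m) * d \<le> card X"
      using \<open>d * m * D \<ge> 1\<close> many by (simp_all add: p A_def mult_ac)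
  qed (use \<open>finite X\<close> h(2) in \<open>auto simp: p\<close>)
  have "(\<Sum>i<d. b i) + (\<Sum>j<m. a j) \<le> (\<Sum>i<d. 2 * B) + (\<Sum>j<m. A)"
    using b x by (intro add_mono sum_mono) (simp_all add: less_imp_le)
  also have "\<dots> < p"
    by (simp add: A_def B_def p algebra_simps)
  finally show ?thesis
    using b x dvd that[of b x a] by simp
qed

subsection \<open>Convex hulls and their interiors\<close>

lemma family_combination_in_conv_hull:
  assumes "finite S" "finite I" "x ` I \<subseteq> S" "\<And>i. i \<in> I \<Longrightarrow> 0 \<le> w i" "(\<Sum>i\<in>I. w i) = 1"
  shows "(\<lambda>l. \<Sum>i\<in>I. w i * x i l) \<in> conv_hull S"
proof -
  define u where "u v = (\<Sum>i | i \<in> I \<and> x i = v. w i)" for v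
  have collect: "(\<Sum>v\<in>S. u v * F v) = (\<Sum>i\<in>I. w i * F (x i))" for F
  proof -
    have "(\<Sum>v\<in>S. u v * F v) = (\<Sum>v\<in>S. \<Sum>i | i \<in> I \<and> x i = v. w i * F (x i))"
      unfolding u_def sum_distrib_right by (intro sum.cong) auto
    also have "\<dots> = (\<Sum>i\<in>I. w i * F (x i))"
      by (rule sum.group[OF \<open>finite I\<close> \<open>finite S\<close> \<open>x ` I \<subseteq> S\<close>])
    finally show ?thesis .
  qed
  have "\<forall>v\<in>S. 0 \<le> u v"
    unfolding u_def using assms(4) by (auto intro: sum_nonneg)
  moreover have "(\<Sum>v\<in>S. u v) = 1"
    using collect[of "\<lambda>_. 1"] assms(5) by simp
  moreover have "(\<lambda>l. \<Sum>i\<in>I. w i * x i l) = (\<lambda>l. \<Sum>v\<in>S. u v * v l)"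
    by (simp add: collect)
  ultimately show ?thesis
    unfolding conv_hull_def by blast
qed

lemma conv_hull_mono:
  assumes "finite V" "S \<subseteq> V"
  shows "conv_hull S \<subseteq> conv_hull V"
proof
  fix x assume "x \<in> conv_hull S"
  then obtain u where u: "\<forall>v\<in>S. 0 \<le> u v" "(\<Sum>v\<in>S. u v) = 1" "x = (\<lambda>i. \<Sum>v\<in>S. u v * v i)"
    unfolding conv_hull_def by blast
  then show "x \<in> conv_hull V"
    using assms family_combination_in_conv_hull[OF \<open>finite V\<close>, of S "\<lambda>v. v" u]
    by (simp add: finite_subset)
qed

lemma conv_hull_subset_Rd: "S \<subseteq> Rd d \<Longrightarrow> conv_hull S \<subseteq> Rd d"
  by (auto simp: conv_hull_def Rd_def subset_iff intro!: sum.neutral)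

lemma base_plus_edges_in_conv_hull:
  assumes "finite S" "finite I" "v \<in> S" "x ` I \<subseteq> S" "\<And>i. i \<in> I \<Longrightarrow> 0 \<le> w i" "(\<Sum>i\<in>I. w i) \<le> 1"
  shows "(\<lambda>l. v l + (\<Sum>i\<in>I. w i * (x i l - v l))) \<in> conv_hull S"
proof -
  define x' where "x' = case_option v x"
  define w' where "w' = case_option (1 - (\<Sum>i\<in>I. w i)) w"
  have sum: "(\<Sum>i\<in>insert None (Some ` I). g i) = g None + (\<Sum>i\<in>I. g (Some i))"
    for g :: "'a option \<Rightarrow> real"
    using \<open>finite I\<close> by (simp add: sum.reindex)
  have "(\<lambda>l. v l + (\<Sum>i\<in>I. w i * (x i l - v l))) = (\<lambda>l. \<Sum>i\<in>insert None (Some ` I). w' i * x' i l)"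
    by (rule ext) (simp add: sum x'_def w'_def right_diff_distrib left_diff_distrib sum_subtractf
        flip: sum_distrib_right)
  also have "\<dots> \<in> conv_hull S"
    using assms by (intro family_combination_in_conv_hull) (auto simp: sum x'_def w'_def)
  finally show ?thesis .
qed

lemma conv_hull_proper_combination:
  assumes "finite V" "x \<in> conv_hull V" "x \<notin> V"
  obtains a b t where "a \<in> V" "b \<in> conv_hull V" "0 < t" "t < 1"
    "x = (\<lambda>i. (1 - t) * b i + t * a i)"
proof -
  obtain u where u: "\<forall>v\<in>V. 0 \<le> u v" "(\<Sum>v\<in>V. u v) = 1" "x = (\<lambda>i. \<Sum>v\<in>V. u v * v i)"
    using assms(2) unfolding conv_hull_def by blast
  have "\<exists>a\<in>V. u a \<noteq> 0"
    using u(2) by (metis sum.neutral zero_neq_one)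
  then obtain a where a: "a \<in> V" "u a > 0"
    using u(1) by (metis order_less_le)
  have remove: "(\<Sum>v\<in>V. u v * F v) = u a * F a + (\<Sum>v\<in>V - {a}. u v * F v)" for F
    using assms(1) a by (simp add: sum.remove)
  have rest: "(\<Sum>v\<in>V - {a}. u v) = 1 - u a"
    using remove[of "\<lambda>_. 1"] u(2) by simp
  have "0 \<le> (\<Sum>v\<in>V - {a}. u v)"
    using u(1) by (intro sum_nonneg) auto
  moreover have "u a \<noteq> 1"
  proof
    assume "u a = 1"
    then have "\<forall>v\<in>V - {a}. u v = 0"
      using rest u(1) assms(1) sum_nonneg_eq_0_iff[of "V - {a}" u] by simp
    then have "x = a"
      using u(3) remove \<open>u a = 1\<close> by simp
    then show False
      using assms(3) a by simp
  qed
  ultimately have "u a < 1"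
    using rest by simp
  define b where "b = (\<lambda>i. \<Sum>v\<in>V - {a}. u v / (1 - u a) * v i)"
  have "b \<in> conv_hull V"
    unfolding b_def using assms(1) u(1) rest \<open>u a < 1\<close>
    by (intro family_combination_in_conv_hull[where x = "\<lambda>v. v"])
       (auto simp flip: sum_divide_distrib)
  moreover have "x = (\<lambda>i. (1 - u a) * b i + u a * a i)"
    unfolding u(3) remove b_def sum_distrib_left using \<open>u a < 1\<close> by (simp add: add.commute)
  ultimately show ?thesis
    using a \<open>u a < 1\<close> by (intro that)
qed

lemma vertices_conv_hull_subset:
  assumes "finite V"
  shows "vertices (conv_hull V) \<subseteq> V"
proof (rule subsetI, rule ccontr)
  fix v assume v: "v \<in> vertices (conv_hull V)" "v \<notin> V"
  then obtain a b t where a: "a \<in> V" and b: "b \<in> conv_hull V" and t: "0 < t" "t < 1"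
    and eq: "v = (\<lambda>i. (1 - t) * b i + t * a i)"
    using assms by (auto simp: vertices_def elim: conv_hull_proper_combination)
  have "a \<in> conv_hull V"
    using family_combination_in_conv_hull[OF assms, of "{a}" "\<lambda>v. v" "\<lambda>_. 1"] a by simp
  moreover have "b \<noteq> a"
    using eq a v(2) by (auto simp: algebra_simps)
  ultimately show False
    using v(1) b t eq unfolding vertices_def by blast
qed

lemma interior_d_mono: "P \<subseteq> P' \<Longrightarrow> interior_d d P \<subseteq> interior_d d P'"
  unfolding interior_d_def by blast

lemma combination_left_inverse:
  fixes R w :: "nat \<Rightarrow> nat \<Rightarrow> real"
  assumes "\<And>i j. i < d \<Longrightarrow> j < d \<Longrightarrow> (\<Sum>k<d. R i k * w k j) = (if i = j then 1 else 0)" "l < d"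
  shows "(\<Sum>i<d. (\<Sum>j<d. v j * R j i) * w i l) = v l"
proof -
  have "(\<Sum>i<d. (\<Sum>j<d. v j * R j i) * w i l) = (\<Sum>j<d. v j * (\<Sum>i<d. R j i * w i l))"
    unfolding sum_distrib_right sum_distrib_left by (subst sum.swap) (simp add: mult.assoc)
  also have "\<dots> = (\<Sum>j<d. if l = j then v j else 0)"
    using assms by (intro sum.cong) auto
  finally show ?thesis
    using \<open>l < d\<close> by simp
qed

lemma small_vector_small_coordinates:
  fixes R :: "nat \<Rightarrow> nat \<Rightarrow> real"
  assumes "\<delta> > 0"
  obtains e where "e > 0"
    "\<And>v. (\<Sum>i<d. (v i)\<^sup>2) < e\<^sup>2 \<Longrightarrow> (\<Sum>i<d. \<bar>\<Sum>j<d. v j * R j i\<bar>) < \<delta>"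
proof -
  define K where "K = (\<Sum>i<d. \<Sum>j<d. \<bar>R j i\<bar>) + 1"
  have "K > 0"
    by (simp add: K_def sum_nonneg add_nonneg_pos)
  show ?thesis
  proof (rule that)
    show "\<delta> / K > 0"
      using assms \<open>K > 0\<close> by simp
    fix v assume v: "(\<Sum>i<d. (v i)\<^sup>2) < (\<delta> / K)\<^sup>2"
    have small: "\<bar>v j\<bar> \<le> \<delta> / K" if "j < d" for j
    proof -
      have "(v j)\<^sup>2 \<le> (\<Sum>i<d. (v i)\<^sup>2)"
        using that by (intro member_le_sum) auto
      then show ?thesis
        using v \<open>\<delta> / K > 0\<close> abs_le_square_iff[of "v j" "\<delta> / K"] by simp
    qed
    have "(\<Sum>i<d. \<bar>\<Sum>j<d. v j * R j i\<bar>) \<le> (\<Sum>i<d. \<Sum>j<d. \<delta> / K * \<bar>R j i\<bar>)"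
      by (intro sum_mono order_trans[OF sum_abs])
         (auto simp only: abs_mult intro!: mult_right_mono small)
    also have "\<dots> = \<delta> / K * (K - 1)"
      unfolding sum_distrib_left[symmetric] by (simp add: K_def)
    also have "\<dots> < \<delta>"
      using assms \<open>K > 0\<close> by (simp add: field_simps)
    finally show "(\<Sum>i<d. \<bar>\<Sum>j<d. v j * R j i\<bar>) < \<delta>" .
  qed
qed

lemma interior_d_if_perturbations:
  fixes R w :: "nat \<Rightarrow> nat \<Rightarrow> real"
  assumes "P \<subseteq> Rd d" "\<delta> > 0"
    and R: "\<And>i j. i < d \<Longrightarrow> j < d \<Longrightarrow> (\<Sum>k<d. R i k * w k j) = (if i = j then 1 else 0)"
    and P: "\<And>c. (\<Sum>i<d. \<bar>c i\<bar>) < \<delta> \<Longrightarrow> (\<lambda>l. z l + (\<Sum>i<d. c i * w i l)) \<in> P"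
  shows "z \<in> interior_d d P"
proof -
  have "z \<in> P"
    using P[of "\<lambda>_. 0"] \<open>\<delta> > 0\<close> by simp
  obtain e where "e > 0"
    and e: "\<And>v. (\<Sum>i<d. (v i)\<^sup>2) < e\<^sup>2 \<Longrightarrow> (\<Sum>i<d. \<bar>\<Sum>j<d. v j * R j i\<bar>) < \<delta>"
    by (rule small_vector_small_coordinates[OF \<open>\<delta> > 0\<close>, of d R]) (rule that)
  have "y \<in> P" if y: "y \<in> Rd d" "(\<Sum>i<d. (y i - z i)\<^sup>2) < e\<^sup>2" for y
  proof -
    define c where "c i = (\<Sum>j<d. (y j - z j) * R j i)" for i
    have in_P: "(\<lambda>l. z l + (\<Sum>i<d. c i * w i l)) \<in> P"
      unfolding c_def using y(2) by (intro P e)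
    also have "(\<lambda>l. z l + (\<Sum>i<d. c i * w i l)) = y"
    proof
      fix l
      show "z l + (\<Sum>i<d. c i * w i l) = y l"
      proof (cases "l < d")
        case True
        have "(\<Sum>i<d. c i * w i l) = y l - z l"
          unfolding c_def by (rule combination_left_inverse[OF R True])
        then show ?thesis by simp
      next
        case False
        then show ?thesis
          using y(1) subsetD[OF \<open>P \<subseteq> Rd d\<close> in_P] by (simp add: Rd_def)
      qed
    qed
    finally show ?thesis .
  qed
  then show ?thesis
    using \<open>e > 0\<close> \<open>z \<in> P\<close> \<open>P \<subseteq> Rd d\<close> by (auto simp: interior_d_def)
qed

lemma positive_combination_in_interior:
  fixes h :: "nat \<Rightarrow> nat \<Rightarrow> real" and x :: "'a \<Rightarrow> nat \<Rightarrow> real"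
  assumes S: "finite S" "S \<subseteq> Rd d" and J: "finite J" "x ` J \<subseteq> S"
    and base: "v \<in> S" "h ` {..<d} \<subseteq> S"
    and R: "\<And>i j. i < d \<Longrightarrow> j < d \<Longrightarrow> (\<Sum>k<d. R i k * (h k j - v j)) = (if i = j then 1 else 0)"
    and \<alpha>: "\<And>i. i < d \<Longrightarrow> 0 < \<alpha> i" and \<beta>: "\<And>j. j \<in> J \<Longrightarrow> 0 \<le> \<beta> j"
    and total: "(\<Sum>i<d. \<alpha> i) + (\<Sum>j\<in>J. \<beta> j) < 1"
  shows "(\<lambda>l. v l + ((\<Sum>i<d. \<alpha> i * (h i l - v l)) + (\<Sum>j\<in>J. \<beta> j * (x j l - v l))))
    \<in> interior_d d (conv_hull S)" (is "?z \<in> _")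
proof -
  define \<delta> where "\<delta> = Min (insert (1 - ((\<Sum>i<d. \<alpha> i) + (\<Sum>j\<in>J. \<beta> j))) (\<alpha> ` {..<d}))"
  have "\<delta> > 0" and \<delta>_le: "\<delta> \<le> 1 - ((\<Sum>i<d. \<alpha> i) + (\<Sum>j\<in>J. \<beta> j))" "\<And>i. i < d \<Longrightarrow> \<delta> \<le> \<alpha> i"
    using \<alpha> total by (auto simp: \<delta>_def)
  have "(\<lambda>l. ?z l + (\<Sum>i<d. c i * (h i l - v l))) \<in> conv_hull S" if c: "(\<Sum>i<d. \<bar>c i\<bar>) < \<delta>" for c
  proof -
    have nonneg: "0 \<le> \<alpha> i + c i" if "i < d" for i
      using member_le_sum[of i "{..<d}" "\<lambda>i. \<bar>c i\<bar>"] that c \<delta>_le(2)[OF that] by simp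
    have "(\<Sum>i<d. c i) \<le> (\<Sum>i<d. \<bar>c i\<bar>)"
      by (intro sum_mono) simp
    then have le_one: "(\<Sum>i<d. \<alpha> i + c i) + (\<Sum>j\<in>J. \<beta> j) \<le> 1"
      using c \<delta>_le(1) by (simp add: sum.distrib)
    have "(\<lambda>l. ?z l + (\<Sum>i<d. c i * (h i l - v l)))
        = (\<lambda>l. v l + (\<Sum>i\<in>{..<d} <+> J. case_sum (\<lambda>i. \<alpha> i + c i) \<beta> i * (case_sum h x i l - v l)))"
      using J(1) by (intro ext) (simp add: sum.Plus distrib_right sum.distrib)
    also have "\<dots> \<in> conv_hull S"
      using S(1) J base \<beta> nonneg le_one
      by (intro base_plus_edges_in_conv_hull) (auto simp: sum.Plus)
    finally show ?thesis .
  qed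
  then show ?thesis
    by (intro interior_d_if_perturbations[OF conv_hull_subset_Rd[OF S(2)] \<open>\<delta> > 0\<close> R])
qed

subsection \<open>Lattice points in the interior\<close>

definition int_vec :: "(nat \<Rightarrow> real) \<Rightarrow> nat \<Rightarrow> int" where
  "int_vec v i = \<lfloor>v i\<rfloor>"

lemma real_int_vec: "lattice_point d v \<Longrightarrow> real_of_int (int_vec v i) = v i"
  by (cases "i < d") (auto simp: int_vec_def lattice_point_def Rd_def elim: Ints_cases)

lemma general_position_imp_general_position_mod_0:
  assumes "finite S" "\<And>v. v \<in> S \<Longrightarrow> lattice_point d v" "general_position d S"
  shows "general_position_mod 0 d int_vec S"
  unfolding general_position_mod_def
proof (intro allI impI, rule ccontr)
  fix y r assume y: "\<exists>i<d. \<not> 0 dvd y i"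
    and "\<not> card {v \<in> S. dot d y (int_vec v) mod 0 = r} \<le> d"
  then have "d + 1 \<le> card {v \<in> S. dot d y (int_vec v) = r}"
    by simp
  then obtain T where T: "T \<subseteq> {v \<in> S. dot d y (int_vec v) = r}" "card T = d + 1"
    by (rule obtain_subset_with_card_n)
  define H where "H = {x \<in> Rd d. (\<Sum>i<d. real_of_int (y i) * x i) = real_of_int r}"
  have "v \<in> H" if "v \<in> T" for v
  proof -
    have "lattice_point d v" "real_of_int (dot d y (int_vec v)) = real_of_int r"
      using that T(1) assms(2) by auto
    then show ?thesis
      by (simp add: H_def dot_def real_int_vec lattice_point_def)
  qed
  moreover have "hyperplane_d d H"
    unfolding hyperplane_d_def H_def using y
    by (intro exI[of _ "\<lambda>i. real_of_int (y i)"] exI[of _ "real_of_int r"]) auto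
  ultimately show False
    using assms(3) T unfolding general_position_def by blast
qed

lemma lattice_simplex_left_inverse:
  assumes "finite S" and lattice: "\<And>v. v \<in> S \<Longrightarrow> lattice_point d v"
    and "general_position_mod 0 d int_vec S" and h: "inj_on h {..d}" "h ` {..d} \<subseteq> S"
  obtains R :: "nat \<Rightarrow> nat \<Rightarrow> real" where "\<And>i j. i < d \<Longrightarrow> j < d \<Longrightarrow>
    (\<Sum>k<d. R i k * (h k j - h d j)) = (if i = j then 1 else 0)"
proof -
  have "nonsingular_mod 0 d (\<lambda>i c. int_vec (h i) c - int_vec (h d) c)"
    using assms(1,3) h by (rule nonsingular_if_general_position_mod)
  then obtain N D where "D \<noteq> 0" and N: "\<And>i j. i < d \<Longrightarrow> j < d \<Longrightarrow>
      (\<Sum>k<d. N i k * (int_vec (h k) j - int_vec (h d) j)) = (if i = j then D else 0)"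
    by (rule nonsingular_left_inverse) (rule that)
  have vertex: "lattice_point d (h k)" if "k \<le> d" for k
    using that h(2) by (intro lattice) auto
  show ?thesis
  proof (rule that)
    fix i j assume "i < d" "j < d"
    have "(\<Sum>k<d. real_of_int (N i k) / real_of_int D * (h k j - h d j))
        = real_of_int (\<Sum>k<d. N i k * (int_vec (h k) j - int_vec (h d) j)) / real_of_int D"
      by (simp add: sum_divide_distrib real_int_vec[OF vertex])
    also have "\<dots> = (if i = j then 1 else 0)"
      using N[OF \<open>i < d\<close> \<open>j < d\<close>] \<open>D \<noteq> 0\<close> by simp
    finally show "(\<Sum>k<d. real_of_int (N i k) / real_of_int D * (h k j - h d j))
        = (if i = j then 1 else 0)" .
  qed
qed

lemma lattice_combination_in_Ints:
  assumes "p > 0" and lattice: "lattice_point d v" "\<And>i. i \<in> I \<Longrightarrow> lattice_point d (h i)"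
      "\<And>j. j \<in> J \<Longrightarrow> lattice_point d (x j)"
    and dvd: "int p dvd (\<Sum>i\<in>I. int (b i) * (int_vec (h i) c - int_vec v c))
      + (\<Sum>j\<in>J. int (a j) * (int_vec (x j) c - int_vec v c))"
  shows "v c + ((\<Sum>i\<in>I. real (b i) / real p * (h i c - v c))
    + (\<Sum>j\<in>J. real (a j) / real p * (x j c - v c))) \<in> \<int>"
proof -
  obtain q where q: "(\<Sum>i\<in>I. int (b i) * (int_vec (h i) c - int_vec v c))
      + (\<Sum>j\<in>J. int (a j) * (int_vec (x j) c - int_vec v c)) = int p * q"
    using dvd by blast
  have "v c + ((\<Sum>i\<in>I. real (b i) / real p * (h i c - v c))
        + (\<Sum>j\<in>J. real (a j) / real p * (x j c - v c)))
      = v c + ((\<Sum>i\<in>I. real (b i) * (h i c - v c)) + (\<Sum>j\<in>J. real (a j) * (x j c - v c))) / real p"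
    by (simp add: add_divide_distrib sum_divide_distrib)
  also have "\<dots> = real_of_int (int_vec v c) + real_of_int (int p * q) / real p"
    unfolding q[symmetric] by (simp add: real_int_vec[OF lattice(1)] real_int_vec[OF lattice(2)]
      real_int_vec[OF lattice(3)])
  also have "\<dots> \<in> \<int>"
    using \<open>p > 0\<close> by simp
  finally show ?thesis .
qed

lemma exists_interior_lattice_point:
  assumes "d > 0" "m > 0" "finite S" and lattice: "\<And>v. v \<in> S \<Longrightarrow> lattice_point d v"
    and "general_position d S"
    and many: "64 * d * m \<le> card S" and large: "(8 * d) ^ d \<le> 2 ^ m"
  shows "\<exists>z. lattice_point d z \<and> z \<in> interior_d d (conv_hull S)"
proof -
  have gp: "general_position_mod 0 d int_vec S"
    using assms by (intro general_position_imp_general_position_mod_0)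
  have "d \<le> d * m"
    using \<open>m > 0\<close> by simp
  then have "card {..d} \<le> card S"
    using many \<open>d > 0\<close> unfolding mult.assoc card_atMost by linarith
  then obtain h where h: "h ` {..d} \<subseteq> S" "inj_on h {..d}"
    using card_le_inj[OF finite_atMost \<open>finite S\<close>] by blast
  then have hS: "h i \<in> S" if "i \<le> d" for i
    using that by auto
  obtain D :: nat where "D > 0" and D: "\<And>n. general_position_mod (int (n * D + 1)) d int_vec S"
    using general_position_mod_mult_plus_one[OF \<open>finite S\<close> gp] by metis
  define p where "p = 4 * d * m * D + 1"
  have "p > 0" and gp_p: "general_position_mod (int p) d int_vec S"
    unfolding p_def by (simp, rule D)
  obtain b a x where b: "\<And>i. i < d \<Longrightarrow> 0 < b i" and x: "\<And>j. j < m \<Longrightarrow> x j \<in> S"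
    and total: "(\<Sum>i<d. b i) + (\<Sum>j<m. a j) < p"
    and dvd: "\<And>c. c < d \<Longrightarrow> int p dvd (\<Sum>i<d. int (b i) * (int_vec (h i) c - int_vec (h d) c))
      + (\<Sum>j<m. int (a j) * (int_vec (x j) c - int_vec (h d) c))"
    by (rule exists_small_combination_dvd[OF assms(1,2) \<open>D > 0\<close> \<open>finite S\<close> p_def gp_p
          h(2,1) many large]) (rule that)
  define z where "z = (\<lambda>l. h d l + ((\<Sum>i<d. real (b i) / real p * (h i l - h d l))
    + (\<Sum>j<m. real (a j) / real p * (x j l - h d l))))"
  obtain R where R: "\<And>i j. i < d \<Longrightarrow> j < d \<Longrightarrow>
      (\<Sum>k<d. R i k * (h k j - h d j)) = (if i = j then 1 else 0)"
    by (rule lattice_simplex_left_inverse[OF \<open>finite S\<close> lattice gp h(2,1)]) (assumption, rule that)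
  have "real ((\<Sum>i<d. b i) + (\<Sum>j<m. a j)) / real p < 1"
    using total \<open>p > 0\<close> by (simp only: divide_less_eq_1_pos of_nat_less_iff of_nat_0_less_iff)
  then have "(\<Sum>i<d. real (b i) / real p) + (\<Sum>j<m. real (a j) / real p) < 1"
    by (simp add: add_divide_distrib sum_divide_distrib)
  then have "z \<in> interior_d d (conv_hull S)"
    unfolding z_def using \<open>finite S\<close> lattice hS x b \<open>p > 0\<close>
    by (intro positive_combination_in_interior[where R = R] R) (auto simp: lattice_point_def)
  moreover have "z c \<in> \<int>" if "c < d" for c
    unfolding z_def using hS x \<open>p > 0\<close> dvd[OF that]
    by (intro lattice_combination_in_Ints[where d = d] lattice) auto
  ultimately show ?thesis
    by (auto simp: lattice_point_def interior_d_def)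
qed

lemma exists_power_two_ge:
  assumes "d \<ge> 2"
  obtains L where "L > 0" "8 * d \<le> 2 ^ L" "real L \<le> 5 * log 2 (real d)"
proof
  define L where "L = nat \<lceil>log 2 (real d)\<rceil> + 3"
  show "L > 0"
    by (simp add: L_def)
  have "log 2 (real d) \<ge> 1"
    using assms by simp
  then have L: "log 2 (real d) + 3 \<le> real L" "real L \<le> 5 * log 2 (real d)"
    unfolding L_def by linarith+
  show "real L \<le> 5 * log 2 (real d)"
    by (rule L(2))
  have "real (8 * d) = 2 powr (log 2 (real d) + 3)"
    using assms by (simp add: powr_add)
  also have "\<dots> \<le> 2 powr real L"
    using L(1) by (rule powr_mono) simp
  also have "\<dots> = real (2 ^ L)"
    by (simp add: powr_realpow)
  finally show "8 * d \<le> 2 ^ L"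
    by (simp only: of_nat_le_iff)
qed

lemma card_vertices_hollow_le:
  assumes "d \<ge> 2" "finite V" "\<And>v. v \<in> V \<Longrightarrow> lattice_point d v"
    and gp: "general_position d (vertices (conv_hull V))"
    and hollow: "\<And>z. lattice_point d z \<Longrightarrow> z \<notin> interior_d d (conv_hull V)"
  shows "real (card (vertices (conv_hull V))) \<le> 320 * (real d)\<^sup>2 * log 2 (real d)"
proof -
  define S where "S = vertices (conv_hull V)"
  have "S \<subseteq> V"
    unfolding S_def using \<open>finite V\<close> by (rule vertices_conv_hull_subset)
  obtain L where L: "L > 0" "8 * d \<le> 2 ^ L" "real L \<le> 5 * log 2 (real d)"
    using exists_power_two_ge[OF \<open>d \<ge> 2\<close>] by metis
  have "\<not> 64 * d * (d * L) \<le> card S"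
  proof
    assume "64 * d * (d * L) \<le> card S"
    moreover have "(8 * d) ^ d \<le> 2 ^ (d * L)"
      using power_mono[OF L(2), of d] by (simp add: mult.commute flip: power_mult)
    moreover have "d * L > 0" "finite S" "general_position d S"
      using L(1) \<open>d \<ge> 2\<close> \<open>finite V\<close> \<open>S \<subseteq> V\<close> gp by (simp_all add: finite_subset S_def)
    moreover have "lattice_point d v" if "v \<in> S" for v
      using assms(3) \<open>S \<subseteq> V\<close> that by blast
    ultimately obtain z where "lattice_point d z" "z \<in> interior_d d (conv_hull S)"
      using exists_interior_lattice_point[of d "d * L" S] \<open>d \<ge> 2\<close> by auto
    then show False
      using hollow interior_d_mono[OF conv_hull_mono[OF \<open>finite V\<close> \<open>S \<subseteq> V\<close>]] by blast
  qed
  then have "real (card S) \<le> real (64 * d * (d * L))"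
    by (simp only: of_nat_le_iff)
  also have "\<dots> = 64 * (real d)\<^sup>2 * real L"
    by (simp add: power2_eq_square)
  also have "\<dots> \<le> 64 * (real d)\<^sup>2 * (5 * log 2 (real d))"
    using L(3) by (rule mult_left_mono) simp
  finally show ?thesis
    by (simp add: S_def)
qed

theorem theorem2p4:
  shows "\<exists>C::real. C > 0 \<and>
    (\<forall>d::nat. \<forall>V::(nat \<Rightarrow> real) set.
       d \<ge> 2 \<longrightarrow> finite V \<longrightarrow> V \<noteq> {} \<longrightarrow> (\<forall>v\<in>V. lattice_point d v) \<longrightarrow>
       general_position d (vertices (conv_hull V)) \<longrightarrow>
       (\<forall>z. lattice_point d z \<longrightarrow> z \<notin> interior_d d (conv_hull V)) \<longrightarrow>
       real (card (vertices (conv_hull V))) \<le> C * real d ^ 2 * (ln (real d)) ^ 3)"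
proof (intro exI[of _ "320 / ln 2 ^ 3"] conjI allI impI)
  fix d :: nat and V :: "(nat \<Rightarrow> real) set"
  assume d: "d \<ge> 2" and "finite V" "\<forall>v\<in>V. lattice_point d v"
    and "general_position d (vertices (conv_hull V))"
    and "\<forall>z. lattice_point d z \<longrightarrow> z \<notin> interior_d d (conv_hull V)"
  then have "real (card (vertices (conv_hull V))) \<le> 320 * (real d)\<^sup>2 * log 2 (real d)"
    by (intro card_vertices_hollow_le) auto
  also have "log 2 (real d) \<le> log 2 (real d) ^ 3"
    using d by (intro self_le_power) auto
  also have "320 * (real d)\<^sup>2 * log 2 (real d) ^ 3 = 320 / ln 2 ^ 3 * real d ^ 2 * ln (real d) ^ 3"
    by (simp add: log_def power_divide)
  finally show "real (card (vertices (conv_hull V)))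
      \<le> 320 / ln 2 ^ 3 * real d ^ 2 * ln (real d) ^ 3"
    by (simp add: mult_left_mono)
qed simp

end
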